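(* There exists a function $c_2:(0,\tfrac12)\to\mathbb{R}$ with $\lim_{\varepsilon\to 0^+}c_2(\varepsilon)=0$ such that for every $\varepsilon\in(0,\tfrac12)$ there are constants $\mu>0$, $C>0$ and $n_0$, depending only on $\varepsilon$, for which the following holds. Let $n\ge n_0$, $p\ge C/n$, $0\le r\le\mu\sqrt{np}$, and let $G$ be a $(p,r)$-pseudorandom directed graph on $n$ vertices. Let $G'$ be a subgraph of $G$ with at least $(1-\varepsilon)|E(G)|$ edges. Then $G'$ contains a directed cycle of length at least $(1-c_2(\varepsilon))\,n$.
   Context: Directed graphs are finite, without loops or multiple parallel edges, but antiparallel edges (both $xy$ and $yx$) are allowed. A directed graph $G=(V,E)$ on $n$ vertices has edge density $p$ if $|E|=pn^2$. For disjoint $A,B\subseteq V$, $e_G(A,B)$ denotes the number of edges of $G$ directed from $A$ to $B$. $G$ is $(p,r)$-pseudorandom if it has edge density $p$ and for every two disjoint sets $A,B\subseteq V$ with $|A|=|B|$, $$\bigl|e_G(A,B)-p|A||B|\bigr|\le r|A|\sqrt{pn}.$$ Directed cycles are simple; the length of a cycle is its number of edges (equivalently vertices). *)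

theory Defs
  imports "HOL-Analysis.Analysis" "Graph_Theory.Graph_Theory"
begin

definition edges_between :: "('a, 'b) pre_digraph \<Rightarrow> 'a set \<Rightarrow> 'a set \<Rightarrow> nat" where
  "edges_between G A B = card {e \<in> arcs G. tail G e \<in> A \<and> head G e \<in> B}"

text \<open>The density is normalised by \<open>n\<^sup>2\<close>, not by the number \<open>n * (n - 1)\<close> of possible edges.\<close>

definition has_edge_density :: "('a, 'b) pre_digraph \<Rightarrow> real \<Rightarrow> bool" where
  "has_edge_density G p \<longleftrightarrow> real (card (arcs G)) = p * real (card (verts G)) ^ 2"

text \<open>The locale \<open>digraph\<close> is that of finite digraphs without loops and parallel arcs;
  antiparallel arcs are allowed.\<close>

definition pseudorandom :: "real \<Rightarrow> real \<Rightarrow> ('a, 'b) pre_digraph \<Rightarrow> bool" where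
  "pseudorandom p r G \<longleftrightarrow>
     digraph G \<and> has_edge_density G p \<and>
     (\<forall>A B. A \<subseteq> verts G \<longrightarrow> B \<subseteq> verts G \<longrightarrow> A \<inter> B = {} \<longrightarrow> card A = card B \<longrightarrow>
        \<bar>real (edges_between G A B) - p * real (card A) * real (card B)\<bar>
          \<le> r * real (card A) * sqrt (p * real (card (verts G))))"

end

theory Submission
  imports Defs
begin

text \<open>
  Two disjoint vertex sets of size \<open>k\<close> span at least
  \<open>p k (k - \<mu> n)\<close> arcs of \<open>G\<close> in either direction, while only \<open>\<epsilon> p n\<^sup>2\<close> arcs of \<open>G\<close> are missing
  from \<open>G'\<close>. Hence for \<open>k\<close> about \<open>2 \<surd>\<epsilon> n\<close> and \<open>\<mu> \<le> \<surd>\<epsilon>\<close>, there is an arc of \<open>G'\<close> from any set of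
  \<open>k\<close> vertices to any disjoint set of \<open>k\<close> vertices.
  Depth-first search turns this into a long path: at the
  moment when the finished and the unvisited vertices are equal in number, no arc leads from the
  former to the latter, so each class has fewer than \<open>k\<close> vertices and the stack is a path through
  all the others (\<open>long_path_if_arcs_between_large_sets\<close>). An arc from the last \<open>k\<close> to the first
  \<open>k\<close> vertices of this path closes a cycle that misses fewer than \<open>4 k\<close> vertices, so
  \<open>c2 \<epsilon> = 8 \<surd>\<epsilon>\<close> works as long as \<open>4 k \<le> n + 2\<close>.

  For larger \<open>k\<close> the required length is below \<open>2\<close>, the least length of a cycle without loops, and
  it is enough that \<open>G'\<close> is not acyclic. This is
  where \<open>\<epsilon> < 1 / 2\<close> enters: in a topological order of an acyclic \<open>G'\<close>, every arc of \<open>G\<close> that goes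
  backwards is missing. Cutting the order into a large constant number \<open>m\<close> of blocks of equal
  size, pseudorandomness shows that almost half of all arcs of \<open>G\<close> go from a block to an earlier
  one, which is more than \<open>\<epsilon> p n\<^sup>2\<close> (\<open>many_backward_arcs\<close>).
\<close>

section \<open>Depth-first search and long cycles\<close>

text \<open>
  The states of a depth-first search: \<open>S\<close> holds the unvisited vertices, \<open>T\<close> the finished ones, and
  \<open>us\<close> is the stack with its top first. A step pushes a vertex of \<open>S\<close> or retires the top of the stack
  to \<open>T\<close>, so it lowers \<open>card S - card T\<close> by exactly one; therefore every value of this difference
  between \<open>card V\<close> and \<open>0\<close> occurs.
\<close>

lemma dfs_state:
  fixes R :: "'a \<Rightarrow> 'a \<Rightarrow> bool"
  assumes "finite V" and "i \<le> card V"
  shows "\<exists>S T us. distinct us \<and> successively R (rev us) \<and> V = S \<union> T \<union> set us \<and>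
           S \<inter> T = {} \<and> S \<inter> set us = {} \<and> T \<inter> set us = {} \<and>
           card S + i = card T + card V \<and> (\<forall>t\<in>T. \<forall>s\<in>S. \<not> R t s)"
  using assms(2)
proof (induction i)
  case 0
  show ?case by (intro exI[of _ V] exI[of _ "{}"] exI[of _ "[]"]) auto
next
  case (Suc i)
  then obtain S T us where st: "distinct us" "successively R (rev us)" "V = S \<union> T \<union> set us"
    "S \<inter> T = {}" "S \<inter> set us = {}" "T \<inter> set us = {}"
    "card S + i = card T + card V" "\<forall>t\<in>T. \<forall>s\<in>S. \<not> R t s"
    by auto
  have fin: "finite S" "finite T" using assms(1) st(3) by auto
  have "card S > 0" using st(7) Suc.prems by linarith
  then have ne: "S \<noteq> {}" by auto
  show ?case
  proof (cases "us = [] \<or> (\<exists>s\<in>S. R (hd us) s)")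
    case True
    then obtain s where s: "s \<in> S" "us = [] \<or> R (hd us) s" using ne by blast
    have "successively R (rev (s # us))"
      using st(2) s(2) by (cases us) (auto simp: successively_append_iff)
    moreover have "card (S - {s}) + Suc i = card T + card V"
      using st(7) s(1) fin(1) \<open>card S > 0\<close> by (simp add: card_Diff_singleton)
    ultimately show ?thesis
      using st s(1) by (intro exI[of _ "S - {s}"] exI[of _ T] exI[of _ "s # us"]) auto
  next
    case False
    then obtain u vs where us: "us = u # vs" by (cases us) auto
    have "successively R (rev vs)"
      using st(2) us by (auto simp: successively_append_iff)
    moreover have "card S + Suc i = card (insert u T) + card V"
      using st(6,7) us fin(2) by simp
    ultimately show ?thesis
      using st us False by (intro exI[of _ S] exI[of _ "insert u T"] exI[of _ vs]) auto
  qed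
qed

lemma long_path_if_arcs_between_large_sets:
  fixes R :: "'a \<Rightarrow> 'a \<Rightarrow> bool"
  assumes "finite V"
    and arcs: "\<And>A B. A \<subseteq> V \<Longrightarrow> B \<subseteq> V \<Longrightarrow> A \<inter> B = {} \<Longrightarrow> card A = k \<Longrightarrow> card B = k \<Longrightarrow>
      \<exists>a\<in>A. \<exists>b\<in>B. R a b"
  shows "\<exists>vs. distinct vs \<and> set vs \<subseteq> V \<and> successively R vs \<and> card V + 2 \<le> length vs + 2 * k"
proof -
  obtain S T us where st: "distinct us" "successively R (rev us)" "V = S \<union> T \<union> set us"
    "S \<inter> T = {}" "S \<inter> set us = {}" "T \<inter> set us = {}"
    "card S = card T" "\<forall>t\<in>T. \<forall>s\<in>S. \<not> R t s"
    using dfs_state[OF assms(1) order_refl, of R] by auto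
  have fin: "finite S" "finite T" using assms(1) st(3) by auto
  have "card T < k"
  proof (rule ccontr)
    assume "\<not> card T < k"
    then obtain A B where AB: "A \<subseteq> T" "card A = k" "B \<subseteq> S" "card B = k"
      by (metis not_less obtain_subset_with_card_n st(7))
    then have "\<exists>a\<in>A. \<exists>b\<in>B. R a b" using st(3,4) by (intro arcs) auto
    then show False using st(8) AB by blast
  qed
  moreover have "card V = card S + card T + length us"
    unfolding st(3) using st(1,4,5,6) fin
    by (subst card_Un_disjoint | force simp: distinct_card)+
  ultimately have "card V + 2 \<le> length us + 2 * k" using st(7) by linarith
  then show ?thesis using st(1,2,3) by (intro exI[of _ "rev us"]) auto
qed

lemma long_cycle_if_arcs_between_large_sets:
  fixes R :: "'a \<Rightarrow> 'a \<Rightarrow> bool"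
  assumes "finite V" and k: "4 * k \<le> card V + 2"
    and arcs: "\<And>A B. A \<subseteq> V \<Longrightarrow> B \<subseteq> V \<Longrightarrow> A \<inter> B = {} \<Longrightarrow> card A = k \<Longrightarrow> card B = k \<Longrightarrow>
      \<exists>a\<in>A. \<exists>b\<in>B. R a b"
  shows "\<exists>vs. vs \<noteq> [] \<and> distinct vs \<and> successively R vs \<and> R (last vs) (hd vs) \<and>
    card V + 4 \<le> length vs + 4 * k"
proof -
  obtain vs where vs: "distinct vs" "set vs \<subseteq> V" "successively R vs"
    "card V + 2 \<le> length vs + 2 * k"
    using long_path_if_arcs_between_large_sets[OF assms(1) arcs] by blast
  define m where "m = length vs"
  have m: "2 * k \<le> m" using vs(4) k m_def by linarith
  let ?A = "set (drop (m - k) vs)" and ?B = "set (take k vs)"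
  have "\<exists>a\<in>?A. \<exists>b\<in>?B. R a b"
  proof (rule arcs)
    show "?A \<subseteq> V" "?B \<subseteq> V" using vs(2) set_drop_subset set_take_subset by fast+
    show "?A \<inter> ?B = {}"
      using set_take_disj_set_drop_if_distinct[OF vs(1), of k "m - k"] m by (simp add: Int_commute)
    show "card ?A = k" "card ?B = k"
      using vs(1) m by (auto simp: distinct_card m_def)
  qed
  then obtain a b where ab: "a \<in> ?A" "b \<in> ?B" "R a b" by blast
  obtain i where i: "i < k" "vs ! i = b" using ab(2) m m_def by (auto simp: in_set_conv_nth)
  obtain j where j: "m - k \<le> j" "j < m" "vs ! j = a"
  proof -
    obtain l where "l < m - (m - k)" "drop (m - k) vs ! l = a"
      using ab(1) by (auto simp: in_set_conv_nth m_def)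
    then show ?thesis using m m_def by (intro that[of "m - k + l"]) auto
  qed
  \<comment> \<open>The cycle leaves out fewer than \<open>k\<close> vertices at each end of the path.\<close>
  have ij: "i \<le> j" using i j m by linarith
  define ws where "ws = drop i (take (Suc j) vs)"
  have len: "length ws = Suc j - i" using j(2) by (simp add: ws_def m_def)
  have "successively R ws"
  proof -
    have "vs = take i vs @ ws @ drop (Suc j) vs"
    proof -
      have "take i (take (Suc j) vs) = take i vs" using ij by (simp add: min_def)
      then have "take (Suc j) vs = take i vs @ ws" unfolding ws_def by (metis append_take_drop_id)
      then show ?thesis by (metis append.assoc append_take_drop_id)
    qed
    then show ?thesis using vs(3) by (metis successively_append_iff)
  qed
  moreover have "hd ws = b"
    using i j ij m_def by (simp add: ws_def hd_drop_conv_nth)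
  moreover have "last ws = a"
    using i j ij m_def by (simp add: ws_def last_conv_nth)
  moreover have "distinct ws" using vs(1) by (simp add: ws_def)
  moreover have "card V + 4 \<le> length ws + 4 * k" using len vs(4) i j m m_def by linarith
  moreover have "ws \<noteq> []" using len ij by auto
  ultimately show ?thesis using ab(3) by blast
qed

section \<open>Cycles given by their vertices\<close>

lemma (in wf_digraph) awalk_through_vertices:
  assumes "u \<in> verts G" and "successively (\<lambda>x y. (x, y) \<in> arcs_ends G) (u # vs)"
  shows "\<exists>p. awalk u p (last (u # vs)) \<and> awalk_verts u p = u # vs"
  using assms
proof (induction vs arbitrary: u)
  case Nil
  then show ?case by (intro exI[of _ "[]"]) (auto simp: awalk_Nil_iff)
next
  case (Cons v vs)
  then obtain e where e: "e \<in> arcs G" "tail G e = u" "head G e = v"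
    by (auto simp: arcs_ends_conv)
  then have "v \<in> verts G" by auto
  then obtain p where p: "awalk v p (last (v # vs))" "awalk_verts v p = v # vs"
    using Cons.IH[of v] Cons.prems(2) by auto
  then show ?case using e by (intro exI[of _ "e # p"]) (auto simp: awalk_Cons_iff)
qed

lemma (in wf_digraph) cycle_through_vertices:
  assumes "vs \<noteq> []" "distinct vs" "successively (\<lambda>x y. (x, y) \<in> arcs_ends G) vs"
    and "(last vs, hd vs) \<in> arcs_ends G"
  shows "\<exists>c. cycle c \<and> length c = length vs"
proof -
  obtain e where e: "e \<in> arcs G" "tail G e = last vs" "head G e = hd vs"
    using assms(4) by (auto simp: arcs_ends_conv)
  have hd: "hd vs \<in> verts G" using e by (metis head_in_verts)
  have vs: "vs = hd vs # tl vs" using assms(1) by simp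
  obtain p where p: "awalk (hd vs) p (last vs)" "awalk_verts (hd vs) p = vs"
    using awalk_through_vertices[OF hd, of "tl vs"] vs assms(3) by metis
  have "awalk (last vs) (e # p) (last vs)" using e p by (simp add: awalk_Cons_iff)
  moreover have "distinct (tl (awalk_verts (last vs) (e # p)))" using e p assms(2) by simp
  moreover have "length (e # p) = length vs"
    using length_awalk_verts[of "hd vs" p] p(2) by simp
  ultimately show ?thesis unfolding cycle_def by blast
qed

lemma (in wf_digraph) acyclic_arcs_ends:
  assumes "\<nexists>c. cycle c"
  shows "acyclic (arcs_ends G)"
  unfolding acyclic_def
proof (intro allI notI)
  fix u assume "(u, u) \<in> (arcs_ends G)\<^sup>+"
  then obtain p where "awalk u p u" "p \<noteq> []" by (auto simp: reachable1_awalk)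
  then have "closed_w p" unfolding closed_w_def by blast
  then show False using closed_w_imp_cycle assms by blast
qed

section \<open>Acyclic subgraphs\<close>

lemma acyclic_topological_order:
  assumes "finite R" "acyclic R" "finite V"
  shows "\<exists>xs. distinct xs \<and> set xs = V \<and> sorted_wrt (\<lambda>x y. (y, x) \<notin> R) xs"
  using assms(3)
proof (induction V rule: finite_psubset_induct)
  case (psubset V)
  show ?case
  proof (cases "V = {}")
    case False
    then obtain z where z: "z \<in> V" "\<And>y. (y, z) \<in> R \<Longrightarrow> y \<notin> V"
      using finite_acyclic_wf[OF assms(1,2)] unfolding wf_eq_minimal by blast
    obtain xs where "distinct xs" "set xs = V - {z}" "sorted_wrt (\<lambda>x y. (y, x) \<notin> R) xs"
      using psubset.IH[of "V - {z}"] z(1) by auto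
    then show ?thesis using z by (intro exI[of _ "z # xs"]) auto
  qed auto
qed

lemma pseudorandom_edges_between_lower:
  assumes "pseudorandom p r G" "card (verts G) = n" "0 \<le> p" "r \<le> \<mu> * sqrt (real n * p)"
    and "A \<subseteq> verts G" "B \<subseteq> verts G" "A \<inter> B = {}" "card A = k" "card B = k"
  shows "p * real k * (real k - \<mu> * real n) \<le> real (edges_between G A B)"
proof -
  have pos: "0 \<le> p * real n" using assms(3) by simp
  have "\<bar>real (edges_between G A B) - p * real k * real k\<bar> \<le> r * real k * sqrt (p * real n)"
    using assms unfolding pseudorandom_def by metis
  moreover have "r * real k * sqrt (p * real n) \<le> \<mu> * sqrt (real n * p) * real k * sqrt (p * real n)"
    using assms(3,4) by (intro mult_right_mono) auto
  moreover have "\<mu> * sqrt (real n * p) * real k * sqrt (p * real n) = \<mu> * real k * (real n * p)"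
    using pos by (simp add: mult.commute[of "real n"] mult.assoc mult.left_commute[of _ "sqrt _"])
  ultimately have "p * real k * real k - \<mu> * real k * (real n * p) \<le> real (edges_between G A B)"
    by linarith
  then show ?thesis by (simp add: algebra_simps)
qed

text \<open>\<open>F\<close> stands for the arcs of \<open>G\<close> that a subgraph with topological order \<open>xs\<close> lacks.
  The arcs between different pairs of blocks are different, so the lower bounds on
  their numbers add up over the \<open>m (m - 1) / 2\<close> pairs.\<close>

lemma many_backward_arcs:
  assumes pr: "pseudorandom p r G" "card (verts G) = n" "0 \<le> p" "r \<le> \<mu> * sqrt (real n * p)"
    and xs: "distinct xs" "set xs = verts G"
    and backward: "sorted_wrt (\<lambda>x y. \<forall>e\<in>arcs G. tail G e = y \<longrightarrow> head G e = x \<longrightarrow> e \<in> F) xs"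
    and "finite F" "m * s \<le> n"
  shows "real m * (real m - 1) / 2 * (p * real s * (real s - \<mu> * real n)) \<le> real (card F)"
proof -
  interpret digraph G using pr(1) by (simp add: pseudorandom_def)
  have len: "length xs = n" using xs pr(2) distinct_card by metis
  \<comment> \<open>The \<open>i\<close>-th block of length \<open>s\<close> of the order; fewer than all vertices may be covered.\<close>
  define B where "B i = (!) xs ` {i * s ..< Suc i * s}" for i
  define E where "E q = {e \<in> arcs G. tail G e \<in> B (snd q) \<and> head G e \<in> B (fst q)}" for q
  define P where "P = (SIGMA j:{..<m}. {..<j})\<inverse>"
  have bound: "l < n" if "l < Suc i * s" "i < m" for l i
    using that \<open>m * s \<le> n\<close> by (meson Suc_leI less_le_trans mult_le_mono1)
  have inj: "inj_on ((!) xs) {..<n}" using xs(1) len by (simp add: inj_on_nth)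
  have index: "\<exists>l<n. x = xs ! l \<and> l div s = i" if x: "x \<in> B i" and i: "i < m" for x i
  proof -
    obtain l where l: "i * s \<le> l" "l < Suc i * s" "x = xs ! l"
      using x by (auto simp: B_def)
    then have "l div s = i" by (intro div_nat_eqI) (auto simp: mult.commute)
    then show ?thesis using l bound[OF l(2) i] by blast
  qed
  have B_sub: "B i \<subseteq> verts G" if "i < m" for i
    using index[OF _ that] xs(2) len nth_mem by blast
  have B_card: "card (B i) = s" if "i < m" for i
  proof -
    have "{i * s ..< Suc i * s} \<subseteq> {..<n}" using bound that by auto
    then show ?thesis unfolding B_def using inj by (subst card_image) (auto intro: inj_on_subset)
  qed
  have B_eq: "i = j" if "x \<in> B i" "x \<in> B j" "i < m" "j < m" for i j x
    using index[OF that(1,3)] index[OF that(2,4)] xs(1) len nth_eq_iff_index_eq by metis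
  have P: "fst q < snd q \<and> snd q < m" if "q \<in> P" for q using that by (auto simp: P_def)
  have finP: "finite P" by (auto simp: P_def)
  have "real (\<Sum>j<l. j) = real l * (real l - 1) / 2" for l
    by (induction l) (auto simp: field_simps)
  then have cardP: "real (card P) = real m * (real m - 1) / 2" by (simp add: P_def)
  have E_F: "E q \<subseteq> F" if q: "q \<in> P" for q
  proof
    fix e assume e: "e \<in> E q"
    obtain l where l: "l < n" "head G e = xs ! l" "l div s = fst q"
      using e P[OF q] index[of "head G e" "fst q"] by (auto simp: E_def)
    obtain l' where l': "l' < n" "tail G e = xs ! l'" "l' div s = snd q"
      using e P[OF q] index[of "tail G e" "snd q"] by (auto simp: E_def)
    have "l < l'" using l(3) l'(3) P[OF q] by (metis div_le_mono leI not_less)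
    then show "e \<in> F" using backward l l' len e unfolding sorted_wrt_iff_nth_less E_def by auto
  qed
  have "real m * (real m - 1) / 2 * (p * real s * (real s - \<mu> * real n))
      = (\<Sum>q\<in>P. p * real s * (real s - \<mu> * real n))" by (simp add: cardP)
  also have "\<dots> \<le> (\<Sum>q\<in>P. real (card (E q)))"
  proof (rule sum_mono)
    fix q assume q: "q \<in> P"
    have "p * real s * (real s - \<mu> * real n) \<le> real (edges_between G (B (snd q)) (B (fst q)))"
      using P[OF q] B_eq[of _ "fst q" "snd q"]
      by (intro pseudorandom_edges_between_lower[OF pr] B_sub B_card) auto
    then show "p * real s * (real s - \<mu> * real n) \<le> real (card (E q))"
      by (simp add: edges_between_def E_def)
  qed
  also have "\<dots> = real (\<Sum>q\<in>P. card (E q))" by simp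
  also have "(\<Sum>q\<in>P. card (E q)) = card (\<Union>q\<in>P. E q)"
  proof (rule card_UN_disjoint[symmetric])
    show "finite P" by (rule finP)
    show "\<forall>q\<in>P. finite (E q)" by (auto simp: E_def)
    show "\<forall>q\<in>P. \<forall>q'\<in>P. q \<noteq> q' \<longrightarrow> E q \<inter> E q' = {}"
    proof (intro ballI impI)
      fix q q' assume q: "q \<in> P" "q' \<in> P" "q \<noteq> q'"
      show "E q \<inter> E q' = {}"
      proof (rule ccontr)
        assume "E q \<inter> E q' \<noteq> {}"
        then obtain e where "e \<in> E q" "e \<in> E q'" by blast
        then have "fst q = fst q'" "snd q = snd q'"
          using P[OF q(1)] P[OF q(2)] B_eq by (auto simp: E_def)
        then show False using q(3) by (simp add: prod_eq_iff)
      qed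
    qed
  qed
  also have "real (card (\<Union>q\<in>P. E q)) \<le> real (card F)"
    using E_F \<open>finite F\<close> by (intro of_nat_mono card_mono) auto
  finally show ?thesis .
qed

text \<open>With \<open>s = n div m\<close> and \<open>\<mu> n \<le> n / m\<^sup>2\<close>, each of the factors \<open>m - 1\<close>, \<open>s\<close> and
  \<open>s - \<mu> n\<close> loses only a fraction of order \<open>1 / m\<close>, so the backward arcs are at least
  \<open>(1 - 4 / m) / 2\<close> of all arcs.\<close>

lemma cycle_if_more_than_half_of_arcs:
  fixes H G :: "('a, 'b) pre_digraph"
  assumes pr: "pseudorandom p r G" "card (verts G) = n" "0 < p" "r \<le> \<mu> * sqrt (real n * p)"
    and sub: "subgraph H G" and H: "(1 - \<epsilon>) * real (card (arcs G)) \<le> real (card (arcs H))"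
    and m: "4 < real m * (1 - 2 * \<epsilon>)" "0 < \<epsilon>" "\<mu> \<le> 1 / real m ^ 2" "m ^ 2 \<le> n"
  shows "\<exists>c. pre_digraph.cycle H c"
proof (rule ccontr)
  assume no_cycle: "\<nexists>c. pre_digraph.cycle H c"
  interpret G: digraph G using pr(1) by (simp add: pseudorandom_def)
  interpret H: wf_digraph H using sub by (simp add: subgraph_def)
  have arcs_sub: "arcs H \<subseteq> arcs G" and tails: "tail H = tail G" and heads: "head H = head G"
    using sub by (auto simp: subgraph_def compatible_def)
  have finH: "finite (arcs H)" using arcs_sub finite_subset G.finite_arcs by blast
  then have "finite (arcs_ends H)" by (simp add: arcs_ends_conv)
  then obtain xs where xs: "distinct xs" "set xs = verts G"
      "sorted_wrt (\<lambda>x y. (y, x) \<notin> arcs_ends H) xs"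
    using acyclic_topological_order[OF _ H.acyclic_arcs_ends[OF no_cycle] G.finite_verts] by blast
  define F where "F = arcs G - arcs H"
  define s where "s = n div m"
  have "sorted_wrt (\<lambda>x y. \<forall>e\<in>arcs G. tail G e = y \<longrightarrow> head G e = x \<longrightarrow> e \<in> F) xs"
    by (rule sorted_wrt_mono_rel[OF _ xs(3)]) (auto simp: F_def arcs_ends_conv tails heads)
  then have "real m * (real m - 1) / 2 * (p * real s * (real s - \<mu> * real n)) \<le> real (card F)"
    using pr xs by (intro many_backward_arcs[where r = r and G = G]) (auto simp: F_def s_def)
  also have "real (card F) = real (card (arcs G)) - real (card (arcs H))"
    using arcs_sub finH G.finite_arcs card_mono[OF G.finite_arcs arcs_sub]
    by (simp add: F_def card_Diff_subset of_nat_diff)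
  also have "\<dots> \<le> \<epsilon> * (p * real n ^ 2)"
    using H pr(1,2) by (simp add: pseudorandom_def has_edge_density_def algebra_simps)
  finally have upper:
    "real m * (real m - 1) / 2 * (p * real s * (real s - \<mu> * real n)) \<le> \<epsilon> * (p * real n ^ 2)" .
  define M where "M = real m"
  define N where "N = real n"
  have M4: "M > 4"
  proof -
    have "M * (1 - 2 * \<epsilon>) \<le> M * 1" using m(2) by (intro mult_left_mono) (auto simp: M_def)
    then show ?thesis using m(1) unfolding M_def by linarith
  qed
  have NM: "M ^ 2 \<le> N" using m(4) unfolding M_def N_def by (metis of_nat_le_iff of_nat_power)
  have N0: "N > 0" using NM M4 by (smt (verit) zero_less_power)
  have "N < (real s + 1) * M"
  proof -
    have "n < (s + 1) * m"
      using M4 M_def dividend_less_div_times[of m n] by (simp add: s_def)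
    then show ?thesis unfolding N_def M_def by (metis of_nat_1 of_nat_add of_nat_less_iff of_nat_mult)
  qed
  then have "N / M - 1 \<le> real s" using M4 by (simp add: field_simps)
  moreover have "N / M * (1 / M) \<ge> 1" using NM M4 by (simp add: field_simps power2_eq_square)
  ultimately have s1: "N / M * (1 - 1 / M) \<le> real s" by (simp add: algebra_simps)
  have "\<mu> * N \<le> 1 / M ^ 2 * N" using m(3) N0 M_def by (intro mult_right_mono) auto
  moreover have "N / M * (1 - 2 / M) = N / M * (1 - 1 / M) - 1 / M ^ 2 * N"
    using M4 by (simp add: field_simps power2_eq_square)
  ultimately have s2: "N / M * (1 - 2 / M) \<le> real s - \<mu> * N" using s1 by linarith
  have "(1 - 4 / M) / 2 * N ^ 2 \<le> (1 - 1 / M) * ((1 - 1 / M) * (1 - 2 / M)) / 2 * N ^ 2"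
  proof -
    define x where "x = 1 / M"
    have x: "0 < x" "x < 1 / 4" using M4 by (auto simp: x_def field_simps)
    have "(1 - x) * ((1 - x) * (1 - 2 * x)) - (1 - 4 * x) = x ^ 2 * (5 - 2 * x)" by algebra
    also have "\<dots> \<ge> 0" using x by simp
    finally have "1 - 4 * x \<le> (1 - x) * ((1 - x) * (1 - 2 * x))" by simp
    then show ?thesis using N0 by (simp add: x_def)
  qed
  also have "\<dots> = M * (M - 1) / 2 * ((N / M * (1 - 1 / M)) * (N / M * (1 - 2 / M)))"
    using M4 by (simp add: field_simps power2_eq_square)
  also have "\<dots> \<le> M * (M - 1) / 2 * (real s * (real s - \<mu> * N))"
    using s1 s2 M4 N0 by (intro mult_left_mono mult_mono) auto
  finally have "p * ((1 - 4 / M) / 2 * N ^ 2) \<le> p * (M * (M - 1) / 2 * (real s * (real s - \<mu> * N)))"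
    using pr(3) by simp
  also have "\<dots> \<le> p * (\<epsilon> * N ^ 2)"
    using upper by (simp add: M_def N_def algebra_simps)
  finally have "(1 - 4 / M) / 2 \<le> \<epsilon>" using pr(3) N0 by simp
  then have "M - 4 \<le> 2 * \<epsilon> * M" using M4 by (simp add: field_simps)
  then show False using m(1) by (simp add: M_def algebra_simps)
qed

section \<open>Long cycles in dense subgraphs of pseudorandom digraphs\<close>

lemma arc_between_if_few_missing:
  assumes "digraph G" "subgraph H G"
    and "real (card (arcs G)) - real (card (arcs H)) < real (edges_between G A B)"
  shows "\<exists>a\<in>A. \<exists>b\<in>B. (a, b) \<in> arcs_ends H"
proof (rule ccontr)
  assume none: "\<not> ?thesis"
  interpret G: digraph G by fact
  have H: "arcs H \<subseteq> arcs G" "tail H = tail G" "head H = head G"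
    using assms(2) by (auto simp: subgraph_def compatible_def)
  have "edges_between G A B \<le> card (arcs G - arcs H)"
    unfolding edges_between_def using none H by (intro card_mono) (auto simp: arcs_ends_conv)
  also have "\<dots> = card (arcs G) - card (arcs H)"
    using H(1) G.finite_arcs by (meson card_Diff_subset finite_subset)
  finally have "real (edges_between G A B) \<le> real (card (arcs G) - card (arcs H))" by simp
  then show False
    using assms(3) card_mono[OF G.finite_arcs H(1)] by (simp add: of_nat_diff)
qed

theorem corollary6:
  shows "\<exists>c2 :: real \<Rightarrow> real. (c2 \<longlongrightarrow> 0) (at_right 0) \<and>
    (\<forall>\<epsilon>. 0 < \<epsilon> \<and> \<epsilon> < 1 / 2 \<longrightarrow>
      (\<exists>(\<mu> :: real) (C :: real) (n0 :: nat). 0 < \<mu> \<and> 0 < C \<and>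
        (\<forall>(n :: nat) (p :: real) (r :: real)
            (G :: ('a, 'b) pre_digraph) (G' :: ('a, 'b) pre_digraph).
          n \<ge> n0 \<longrightarrow> p \<ge> C / real n \<longrightarrow> 0 \<le> r \<longrightarrow> r \<le> \<mu> * sqrt (real n * p) \<longrightarrow>
          card (verts G) = n \<longrightarrow> pseudorandom p r G \<longrightarrow>
          subgraph G' G \<longrightarrow>
          real (card (arcs G')) \<ge> (1 - \<epsilon>) * real (card (arcs G)) \<longrightarrow>
          (\<exists>c. pre_digraph.cycle G' c \<and> real (length c) \<ge> (1 - c2 \<epsilon>) * real n))))"
proof (intro exI[of _ "\<lambda>\<epsilon>. 8 * sqrt \<epsilon>"] conjI allI impI)
  have "((\<lambda>\<epsilon>. 8 * sqrt \<epsilon>) \<longlongrightarrow> 8 * sqrt 0) (at_right 0)" by (intro tendsto_intros)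
  then show "((\<lambda>\<epsilon>. 8 * sqrt \<epsilon>) \<longlongrightarrow> 0) (at_right 0)" by simp
next
  fix \<epsilon> :: real assume "0 < \<epsilon> \<and> \<epsilon> < 1 / 2"
  then have \<epsilon>: "0 < \<epsilon>" "0 < 1 - 2 * \<epsilon>" by auto
  obtain m :: nat where "4 / (1 - 2 * \<epsilon>) < real m" using reals_Archimedean2 by blast
  then have m: "4 < real m * (1 - 2 * \<epsilon>)" using \<epsilon>(2) by (simp add: field_simps)
  then have m0: "m > 0" by (cases m) auto
  define \<mu> where "\<mu> = min (sqrt \<epsilon>) (1 / real m ^ 2)"
  have \<mu>: "0 < \<mu>" "\<mu> \<le> sqrt \<epsilon>" "\<mu> \<le> 1 / real m ^ 2" using \<epsilon> m0 by (auto simp: \<mu>_def)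
  show "\<exists>(\<mu> :: real) (C :: real) (n0 :: nat). 0 < \<mu> \<and> 0 < C \<and>
        (\<forall>(n :: nat) (p :: real) (r :: real)
            (G :: ('a, 'b) pre_digraph) (G' :: ('a, 'b) pre_digraph).
          n \<ge> n0 \<longrightarrow> p \<ge> C / real n \<longrightarrow> 0 \<le> r \<longrightarrow> r \<le> \<mu> * sqrt (real n * p) \<longrightarrow>
          card (verts G) = n \<longrightarrow> pseudorandom p r G \<longrightarrow>
          subgraph G' G \<longrightarrow>
          real (card (arcs G')) \<ge> (1 - \<epsilon>) * real (card (arcs G)) \<longrightarrow>
          (\<exists>c. pre_digraph.cycle G' c \<and> real (length c) \<ge> (1 - 8 * sqrt \<epsilon>) * real n))"
  proof (rule exI[of _ \<mu>], rule exI[of _ 1], rule exI[of _ "m ^ 2"], intro conjI allI impI)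
    show "0 < \<mu>" "0 < (1 :: real)" using \<mu> by auto
    fix n :: nat and p r :: real and G H :: "('a, 'b) pre_digraph"
    assume n: "n \<ge> m ^ 2" and "p \<ge> 1 / real n" and r: "r \<le> \<mu> * sqrt (real n * p)"
      and G: "card (verts G) = n" "pseudorandom p r G" and sub: "subgraph H G"
      and many: "real (card (arcs H)) \<ge> (1 - \<epsilon>) * real (card (arcs G))"
    have n0: "n > 0" using n m0 by (metis neq0_conv not_le zero_less_power)
    then have p: "p > 0" using \<open>p \<ge> 1 / real n\<close> by (smt (verit) of_nat_0_less_iff zero_less_divide_iff)
    interpret G: digraph G using G(2) by (simp add: pseudorandom_def)
    interpret H: wf_digraph H using sub by (simp add: subgraph_def)
    define k where "k = nat \<lceil>2 * sqrt \<epsilon> * real n\<rceil>"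
    have "0 < 2 * sqrt \<epsilon> * real n" using \<epsilon>(1) n0 by simp
    then have k: "2 * sqrt \<epsilon> * real n \<le> real k" "real k < 2 * sqrt \<epsilon> * real n + 1"
      unfolding k_def by linarith+
    have arcs: "\<exists>a\<in>A. \<exists>b\<in>B. (a, b) \<in> arcs_ends H"
      if "A \<subseteq> verts G" "B \<subseteq> verts G" "A \<inter> B = {}" "card A = k" "card B = k" for A B
    proof (rule arc_between_if_few_missing[OF G.digraph_axioms sub])
      have "real (card (arcs G)) - real (card (arcs H)) \<le> \<epsilon> * (p * real n ^ 2)"
        using many G by (simp add: pseudorandom_def has_edge_density_def algebra_simps)
      also have "\<dots> < p * ((2 * sqrt \<epsilon> * real n) * (sqrt \<epsilon> * real n))"
        using \<epsilon>(1) p n0 by (simp add: power2_eq_square)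
      also have "\<dots> \<le> p * (real k * (real k - \<mu> * real n))"
      proof -
        have "\<mu> * real n \<le> sqrt \<epsilon> * real n" using \<mu>(2) by (intro mult_right_mono) auto
        then have "sqrt \<epsilon> * real n \<le> real k - \<mu> * real n" using k(1) by linarith
        then show ?thesis using k(1) p \<epsilon>(1) by (intro mult_left_mono mult_mono) auto
      qed
      also have "\<dots> \<le> real (edges_between G A B)"
        using pseudorandom_edges_between_lower[OF G(2,1) less_imp_le[OF p] r that]
        by (simp add: mult.assoc)
      finally show "real (card (arcs G)) - real (card (arcs H)) < real (edges_between G A B)" .
    qed
    show "\<exists>c. pre_digraph.cycle H c \<and> real (length c) \<ge> (1 - 8 * sqrt \<epsilon>) * real n"
    proof (cases "4 * k \<le> n + 2")
      case True
      obtain vs where vs: "vs \<noteq> []" "distinct vs" "successively (\<lambda>x y. (x, y) \<in> arcs_ends H) vs"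
        "(last vs, hd vs) \<in> arcs_ends H" "n + 4 \<le> length vs + 4 * k"
        using long_cycle_if_arcs_between_large_sets
          [OF G.finite_verts, of k "\<lambda>x y. (x, y) \<in> arcs_ends H"] arcs True G(1) by auto
      have "real n + 4 \<le> real (length vs) + 4 * real k" using vs(5) by linarith
      then have "(1 - 8 * sqrt \<epsilon>) * real n \<le> real (length vs)"
        using k(2) by (simp add: algebra_simps)
      then show ?thesis using H.cycle_through_vertices[OF vs(1-4)] by metis
    next
      case False
      \<comment> \<open>The bound asks for less than two arcs, so any cycle will do.\<close>
      obtain c where c: "H.cycle c"
        using cycle_if_more_than_half_of_arcs[OF G(2,1) p r sub many m \<epsilon>(1) \<mu>(3) n]
        by blast
      interpret H: loopfree_digraph H
        using sub G.no_loops by unfold_locales (auto simp: subgraph_def compatible_def)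
      have "2 \<le> length c" using c H.cycle_digraph_conv by blast
      moreover have "real n + 2 < 4 * real k" using False by linarith
      then have "(1 - 8 * sqrt \<epsilon>) * real n < 2" using k(2) by (simp add: algebra_simps)
      ultimately show ?thesis using c by (intro exI[of _ c]) auto
    qed
  qed
qed

end
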